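(* Let $m\equiv 0\pmod 4$ be a positive integer and let $n\geqslant 2$ be an integer. Then, for every integer $k$ with $1\le k\le n-1$, \[ \operatorname{mult}_{\mathcal P_m(n)}(2k)\;\geqslant\;\begin{cases} 3, & 1\leqslant k\leqslant n-1,\ k\neq\lfloor n/2\rfloor,\\ 2, & k=\lfloor n/2\rfloor,\end{cases} \] where $\mathcal P_m(n)$ is the generalised pancake graph and $\operatorname{mult}_\Gamma(\lambda)$ denotes the multiplicity of $\lambda$ as an eigenvalue of the adjacency matrix of a graph $\Gamma$.
   Context: Write $[n]=\{1,\dots,n\}$ and $\mathbb Z_m=\mathbb Z/m\mathbb Z$. Let $S(m,n)=\mathbb Z_m\wr S_n$ be the set of $m$-coloured permutations: pairs $\sigma=(\chi,\psi)$ with $\chi:[n]\to\mathbb Z_m$ a function (the colour function; $\chi(t)$ is the colour of the entry in position $t$) and $\psi\in S_n$ a permutation. In one-line notation, $\sigma=(\psi(1)^{\chi(1)},\dots,\psi(n)^{\chi(n)})$. For $1\le k\le n$ and $\varepsilon\in\{\pm1\}$ (superscripts $+$, $-$ abbreviate $+1$, $-1$), the prefix reversal $r_k^{\varepsilon}:S(m,n)\to S(m,n)$ is the map $(\chi,\psi)\mapsto(\chi',\psi')$ with $\psi'(t)=\psi(k+1-t)$ and $\chi'(t)=\chi(k+1-t)+\varepsilon \pmod m$ for $1\le t\le k$, and $\psi'(t)=\psi(t)$, $\chi'(t)=\chi(t)$ for $k<t\le n$. For $m\ge3$, the generalised pancake graph $\mathcal P_m(n)$ is the undirected (Cayley) graph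 $\mathrm{Cay}(S(m,n),R_m)$ with $R_m=\{r_k^{-}:1\le k\le n\}\cup\{r_k^{+}:1\le k\le n\}$. That is, its vertices are the elements of $S(m,n)$, and two vertices are adjacent if and only if one can be obtained from the other by applying a prefix reversal $r_k^{\varepsilon}$. It is $2n$-regular. *)

theory Defs
  imports
    "Graph_Theory.Pair_Digraph"
    "Jordan_Normal_Form.Char_Poly"
    "Jordan_Normal_Form.Matrix_Kernel"
begin

text \<open>A colour in $\mathbb{Z}_m$ is represented by its residue in \<open>{0..<int m}\<close>.  Colour functions
  take the value \<open>undefined\<close> outside \<open>{1..n}\<close> and permutations are the identity there, so that every
  coloured permutation has exactly one representative.\<close>

definition coloured_perms :: "nat \<Rightarrow> nat \<Rightarrow> ((nat \<Rightarrow> int) \<times> (nat \<Rightarrow> nat)) set" where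
  "coloured_perms m n = ({1..n} \<rightarrow>\<^sub>E {0..<int m}) \<times> {\<psi>. \<psi> permutes {1..n}}"

definition prefix_reversal ::
  "nat \<Rightarrow> nat \<Rightarrow> int \<Rightarrow> (nat \<Rightarrow> int) \<times> (nat \<Rightarrow> nat) \<Rightarrow> (nat \<Rightarrow> int) \<times> (nat \<Rightarrow> nat)" where
  "prefix_reversal m k \<epsilon> = (\<lambda>(\<chi>, \<psi>).
     (\<lambda>t. if t \<in> {1..k} then (\<chi> (k + 1 - t) + \<epsilon>) mod int m else \<chi> t,
      \<lambda>t. if t \<in> {1..k} then \<psi> (k + 1 - t) else \<psi> t))"

text \<open>An undirected graph is encoded as a symmetric relation.\<close>

definition pancake_graph :: "nat \<Rightarrow> nat \<Rightarrow> ((nat \<Rightarrow> int) \<times> (nat \<Rightarrow> nat)) pair_pre_digraph" where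
  "pancake_graph m n =
     \<lparr> pverts = coloured_perms m n,
       parcs = {(\<sigma>, \<tau>). \<sigma> \<in> coloured_perms m n \<and> \<tau> \<in> coloured_perms m n \<and>
         (\<exists>k\<in>{1..n}. \<exists>\<epsilon>\<in>{1, -1}.
            \<tau> = prefix_reversal m k \<epsilon> \<sigma> \<or> \<sigma> = prefix_reversal m k \<epsilon> \<tau>)} \<rparr>"

text \<open>\<open>vs\<close> is an enumeration of the vertices without repetition.\<close>

definition adjacency_matrix :: "'v list \<Rightarrow> 'v pair_pre_digraph \<Rightarrow> real mat" where
  "adjacency_matrix vs G =
     mat (length vs) (length vs) (\<lambda>(i, j). if (vs ! i, vs ! j) \<in> parcs G then 1 else 0)"

text \<open>The multiplicity is the dimension of the eigenspace.  For an undirected graph the adjacency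
  matrix is real symmetric, so this is also the multiplicity as a root of the characteristic
  polynomial.  It does not depend on the enumeration chosen; \<open>G\<close> has to be finite for one to exist.\<close>

definition eigenvalue_mult :: "'v pair_pre_digraph \<Rightarrow> real \<Rightarrow> nat" where
  "eigenvalue_mult G ev =
     kernel_dim (char_matrix (adjacency_matrix (SOME vs. distinct vs \<and> set vs = pverts G) G) ev)"

lemma finite_coloured_perms: "finite (coloured_perms m n)"
  unfolding coloured_perms_def by (intro finite_cartesian_product finite_PiE finite_permutations) auto

lemma prefix_reversal_in_coloured_perms:
  assumes k: "k \<in> {1..n}" and "m > 0" and s: "\<sigma> \<in> coloured_perms m n"
  shows "prefix_reversal m k \<epsilon> \<sigma> \<in> coloured_perms m n"
proof -
  obtain \<chi> \<psi> where \<sigma>: "\<sigma> = (\<chi>, \<psi>)" by force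
  define \<rho> where "\<rho> = (\<lambda>t. if t \<in> {1..k} then k + 1 - t else t)"
  have "\<rho> permutes {1..n}"
    unfolding permutes_def
  proof (intro conjI allI impI)
    show "\<rho> x = x" if "x \<notin> {1..n}" for x using that k by (auto simp: \<rho>_def)
    show "\<exists>!x. \<rho> x = y" for y
      by (rule ex1I[of _ "\<rho> y"]) (auto simp: \<rho>_def split: if_splits)
  qed
  then have "\<psi> \<circ> \<rho> permutes {1..n}"
    using s \<sigma> permutes_compose by (auto simp: coloured_perms_def)
  moreover have "(\<lambda>t. if t \<in> {1..k} then \<psi> (k + 1 - t) else \<psi> t) = \<psi> \<circ> \<rho>"
    by (auto simp: \<rho>_def)
  ultimately show ?thesis
    using s k \<open>m > 0\<close> unfolding \<sigma> by (auto simp: coloured_perms_def prefix_reversal_def PiE_iff extensional_def)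
qed

lemma pair_graph_pancake_graph:
  assumes "m \<ge> 3"
  shows "pair_graph (pancake_graph m n)"
proof -
  have ne: "prefix_reversal m k \<epsilon> \<sigma> \<noteq> \<sigma>"
    if k: "k \<in> {1..n}" and e: "\<epsilon> \<in> {1, -1}" and s: "\<sigma> \<in> coloured_perms m n" for k \<epsilon> \<sigma>
  proof
    assume eq: "prefix_reversal m k \<epsilon> \<sigma> = \<sigma>"
    obtain \<chi> \<psi> where \<sigma>: "\<sigma> = (\<chi>, \<psi>)" by force
    have inj: "inj \<psi>" using s \<sigma> permutes_inj by (auto simp: coloured_perms_def)
    have "fst (prefix_reversal m k \<epsilon> \<sigma>) 1 = \<chi> 1" "snd (prefix_reversal m k \<epsilon> \<sigma>) 1 = \<psi> 1"
      using eq \<sigma> by auto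
    then have c: "(\<chi> k + \<epsilon>) mod int m = \<chi> 1" and p: "\<psi> k = \<psi> 1"
      using k \<sigma> by (auto simp: prefix_reversal_def)
    from p inj have "k = 1" by (auto dest: injD)
    with c have "(\<chi> 1 + \<epsilon>) mod int m = \<chi> 1 mod int m"
      by (metis mod_mod_trivial)
    then have "int m dvd \<epsilon>" by (metis add_diff_cancel_left' mod_eq_dvd_iff)
    then show False using e assms zdvd_imp_le[of "int m" 1] by auto
  qed
  show ?thesis
  proof
    show "finite (parcs (pancake_graph m n))"
      by (rule finite_subset[of _ "coloured_perms m n \<times> coloured_perms m n"])
        (auto simp: pancake_graph_def finite_coloured_perms)
    show "symmetric (pancake_graph m n)"
      unfolding symmetric_def with_proj_simps
    proof (rule symI)
      fix \<sigma> \<tau>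
      assume "(\<sigma>, \<tau>) \<in> parcs (pancake_graph m n)"
      then show "(\<tau>, \<sigma>) \<in> parcs (pancake_graph m n)"
        unfolding pancake_graph_def by (simp only: pair_pre_digraph.simps mem_Collect_eq case_prod_conv) blast
    qed
    fix e
    assume "e \<in> parcs (pancake_graph m n)"
    then obtain \<sigma> \<tau> k \<epsilon> where e: "e = (\<sigma>, \<tau>)" "\<sigma> \<in> coloured_perms m n" "\<tau> \<in> coloured_perms m n"
      "k \<in> {1..n}" "\<epsilon> \<in> {1, -1}"
      "\<tau> = prefix_reversal m k \<epsilon> \<sigma> \<or> \<sigma> = prefix_reversal m k \<epsilon> \<tau>"
      unfolding pancake_graph_def by (simp only: pair_pre_digraph.simps mem_Collect_eq split: prod.splits) blast
    then show "fst e \<noteq> snd e"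
      unfolding e(1) fst_conv snd_conv using ne by metis
  qed (auto simp: pancake_graph_def finite_coloured_perms)
qed

end

theory Submission
  imports Defs
begin

text \<open>
  The eigenvalue \<open>2 k\<close> has multiplicity at least \<open>2 n\<close>, because there are \<open>2 n\<close> linearly independent
  eigenfunctions that look at a single position, namely \<open>q = k + 1\<close>.  Fix a value \<open>v\<close> and let
  \<open>f(\<chi>, \<psi>)\<close> be \<open>cos (\<pi>/2 (\<chi>(q) - c))\<close> if \<open>\<psi>(q) = v\<close>, and \<open>0\<close> otherwise.  This is well
  defined on residues modulo \<open>m\<close> because the cosine has period 4 in the colour and 4 divides \<open>m\<close>.

  Sum \<open>f\<close> over the neighbours of a vertex.  A reversal of a prefix of length \<open>j \<le> k\<close> does not touch
  position \<open>q\<close>, so the \<open>2 k\<close> such reversals contribute \<open>2 k f\<close>.  For \<open>j \<ge> q\<close> the two reversals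
  \<open>r\<^sub>j\<^sup>+\<close> and \<open>r\<^sub>j\<^sup>-\<close> bring the same entry to position \<open>q\<close>, with its colour raised respectively
  lowered by 1.  The two arguments of the cosine then differ by \<open>\<pi>\<close>, and the two values cancel.  So \<open>f\<close> is
  an eigenfunction for \<open>2 k\<close>.

  With \<open>v\<close> in \<open>{1..n}\<close> and \<open>c\<close> in \<open>{0, 1}\<close> (a cosine and a sine) these functions are linearly
  independent: for each pair \<open>(v, c)\<close> there is a coloured permutation whose entry at \<open>q\<close> is \<open>v\<close> with
  colour \<open>c\<close>, and on these vertices the functions form the identity matrix.  Since \<open>n \<ge> 2\<close>, the
  resulting bound \<open>2 n\<close> is at least 4, which exceeds both bounds claimed.
\<close>

section \<open>A lower bound for the dimension of an eigenspace\<close>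

text \<open>Row reduction preserves the kernel, and a matrix in row echelon form has an explicit finite
  basis of its kernel.\<close>

lemma kernel_fin_dim:
  assumes A: "(A :: 'a :: field mat) \<in> carrier_mat nr nc"
  shows "vectorspace.fin_dim class_ring (module_vec TYPE('a) nc\<lparr>carrier := mat_kernel A\<rparr>)"
proof -
  define B where "B = gauss_jordan_single A"
  note gj = gauss_jordan_single[OF A B_def[symmetric]]
  interpret K: kernel nr nc B using gj by unfold_locales auto
  have ref: "row_echelon_form B" and B: "B \<in> carrier_mat nr nc" using gj by auto
  have "K.basis (set (find_base_vectors B))"
    using find_base_vectors(3)[OF ref B] .
  then have "K.Ker.fin_dim"
    unfolding K.Ker.fin_dim_def K.Ker.basis_def using finite_set by blast
  moreover have "mat_kernel B = mat_kernel A"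
    unfolding mat_kernel_def using gj A B by auto
  ultimately show ?thesis by simp
qed

text \<open>Linear independence is certified by evaluation: reading a vanishing linear combination at the
  index \<open>p j\<close> isolates the coefficient of \<open>w j\<close>.\<close>

lemma card_le_kernel_dim:
  fixes A :: "'a :: field mat" and w :: "'i \<Rightarrow> 'a vec" and p :: "'i \<Rightarrow> nat"
  assumes A: "A \<in> carrier_mat nr nc"
    and I: "finite I"
    and ker: "\<And>i. i \<in> I \<Longrightarrow> w i \<in> mat_kernel A"
    and p: "\<And>i. i \<in> I \<Longrightarrow> p i < nc"
    and delta: "\<And>i j. i \<in> I \<Longrightarrow> j \<in> I \<Longrightarrow> w i $ p j = (if i = j then 1 else 0)"
  shows "card I \<le> kernel_dim A"
proof -
  interpret K: kernel nr nc A using A by unfold_locales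
  have inj: "inj_on w I"
    using delta by (intro inj_onI) (metis zero_neq_one)
  have sub: "w ` I \<subseteq> mat_kernel A" using ker by auto
  have "K.lin_indpt (w ` I)"
  proof (rule K.Ker.finite_lin_indpt2)
    fix a assume lc: "K.lincomb a (w ` I) = 0\<^sub>v nc"
    show "\<forall>v\<in>w ` I. a v = 0"
    proof
      fix v assume "v \<in> w ` I"
      then obtain j where j: "j \<in> I" "v = w j" by auto
      have "0 = K.lincomb a (w ` I) $ p j" using lc p[OF j(1)] by simp
      also have "\<dots> = (\<Sum>i\<in>I. a (w i) * w i $ p j)"
        by (simp add: K.lincomb_index[OF p[OF j(1)] sub] sum.reindex[OF inj])
      also have "\<dots> = (\<Sum>i\<in>I. if i = j then a (w i) else 0)"
        by (rule sum.cong) (auto simp: delta j)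
      also have "\<dots> = a v" using I j by simp
      finally show "a v = 0" ..
    qed
  qed (use I sub in auto)
  then have "card (w ` I) \<le> K.dim"
    using K.Ker.li_le_dim(2)[OF kernel_fin_dim[OF A]] sub by auto
  then show ?thesis
    using A by (simp add: kernel_dim_def card_image[OF inj])
qed

text \<open>The previous bound in terms of functions on the vertices, so that no enumeration of the vertices
  appears in what follows.\<close>

lemma card_le_eigenvalue_mult:
  fixes G :: "'v pair_pre_digraph" and f :: "'i \<Rightarrow> 'v \<Rightarrow> real" and p :: "'i \<Rightarrow> 'v"
  assumes fin: "finite (pverts G)" and I: "finite I"
    and eigen: "\<And>i x. i \<in> I \<Longrightarrow> x \<in> pverts G \<Longrightarrow>
      (\<Sum>y\<in>{y \<in> pverts G. (x, y) \<in> parcs G}. f i y) = ev * f i x"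
    and p: "\<And>i. i \<in> I \<Longrightarrow> p i \<in> pverts G"
    and delta: "\<And>i j. i \<in> I \<Longrightarrow> j \<in> I \<Longrightarrow> f i (p j) = (if i = j then 1 else 0)"
  shows "card I \<le> eigenvalue_mult G ev"
proof -
  define vs where "vs = (SOME vs. distinct vs \<and> set vs = pverts G)"
  have "\<exists>vs. distinct vs \<and> set vs = pverts G"
    using finite_distinct_list[OF fin] by auto
  then have vs: "distinct vs" "set vs = pverts G"
    unfolding vs_def by (metis (mono_tags, lifting) someI_ex)+
  define N where "N = length vs"
  define A where "A = adjacency_matrix vs G"
  have A: "A \<in> carrier_mat N N" by (simp add: A_def N_def adjacency_matrix_def)
  define w where "w i = vec N (\<lambda>a. f i (vs ! a))" for i
  have "\<forall>i\<in>I. \<exists>a<N. vs ! a = p i"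
    using p vs(2) by (metis N_def in_set_conv_nth)
  then obtain q where q: "\<And>i. i \<in> I \<Longrightarrow> q i < N \<and> vs ! q i = p i" by metis
  have bij: "bij_betw ((!) vs) {..<N} (pverts G)"
    using bij_betw_nth[OF vs(1)] vs(2) by (simp add: N_def)
  have ker: "w i \<in> mat_kernel (char_matrix A ev)" if i: "i \<in> I" for i
  proof (rule mat_kernelI[OF char_matrix_closed[OF A]])
    show "w i \<in> carrier_vec N" by (simp add: w_def)
    have "A *\<^sub>v w i = ev \<cdot>\<^sub>v w i"
    proof (rule eq_vecI)
      fix a assume "a < dim_vec (ev \<cdot>\<^sub>v w i)"
      then have a: "a < N" by (simp add: w_def)
      then have va: "vs ! a \<in> pverts G" using vs(2) by (metis N_def nth_mem)
      have "(A *\<^sub>v w i) $ a = (\<Sum>b<N. A $$ (a, b) * f i (vs ! b))"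
        using A a by (simp add: w_def scalar_prod_def lessThan_atLeast0)
      also have "\<dots> = (\<Sum>b<N. if (vs ! a, vs ! b) \<in> parcs G then f i (vs ! b) else 0)"
        using a by (intro sum.cong) (auto simp: A_def N_def adjacency_matrix_def)
      also have "\<dots> = (\<Sum>y\<in>pverts G. if (vs ! a, y) \<in> parcs G then f i y else 0)"
        by (rule sum.reindex_bij_betw[OF bij])
      also have "\<dots> = ev * f i (vs ! a)"
        using eigen[OF i va] fin by (simp add: sum.inter_filter)
      finally show "(A *\<^sub>v w i) $ a = (ev \<cdot>\<^sub>v w i) $ a" using a by (simp add: w_def)
    qed (use A in \<open>simp add: w_def\<close>)
    then show "char_matrix A ev *\<^sub>v w i = 0\<^sub>v N"
      using A by (intro eq_vecI) (auto simp: char_matrix_def add_mult_distrib_mat_vec[of _ N N] w_def)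
  qed
  have "card I \<le> kernel_dim (char_matrix A ev)"
  proof (rule card_le_kernel_dim[OF char_matrix_closed[OF A] I ker])
    show "w i $ q j = (if i = j then 1 else 0)" if "i \<in> I" "j \<in> I" for i j
      using that q delta by (simp add: w_def)
  qed (use q in auto)
  then show ?thesis by (simp add: eigenvalue_mult_def A_def vs_def)
qed

section \<open>Neighbours in the pancake graph\<close>

lemma prefix_reversal_inverse:
  assumes "m > 0" and "\<sigma> \<in> coloured_perms m n" and "j \<in> {1..n}"
  shows "prefix_reversal m j (- \<epsilon>) (prefix_reversal m j \<epsilon> \<sigma>) = \<sigma>"
proof -
  obtain \<chi> \<psi> where \<sigma>: "\<sigma> = (\<chi>, \<psi>)" by force
  have "\<chi> t mod int m = \<chi> t" if "t \<in> {1..j}" for t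
    using assms that \<sigma> by (auto simp: coloured_perms_def PiE_iff)
  then show ?thesis
    by (auto simp: \<sigma> prefix_reversal_def fun_eq_iff mod_simps)
qed

text \<open>Adjacency allows a reversal in either direction, but \<open>r\<^sub>j\<^sup>+\<close> and \<open>r\<^sub>j\<^sup>-\<close> are mutually inverse,
  so the reversals of \<open>\<sigma>\<close> itself already give every neighbour.\<close>

lemma neighbours_pancake_graph:
  assumes "m > 0" and \<sigma>: "\<sigma> \<in> coloured_perms m n"
  shows "{\<tau> \<in> pverts (pancake_graph m n). (\<sigma>, \<tau>) \<in> parcs (pancake_graph m n)} =
    (\<lambda>(j, \<epsilon>). prefix_reversal m j \<epsilon> \<sigma>) ` ({1..n} \<times> {1, -1})" (is "?L = ?R")
proof (intro equalityI subsetI)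
  fix \<tau> assume "\<tau> \<in> ?L"
  then obtain j \<epsilon> where *: "\<tau> \<in> coloured_perms m n" "j \<in> {1..n}" "\<epsilon> \<in> {1, -1 :: int}"
    and "\<tau> = prefix_reversal m j \<epsilon> \<sigma> \<or> \<sigma> = prefix_reversal m j \<epsilon> \<tau>"
    unfolding pancake_graph_def by (simp only: pair_pre_digraph.simps mem_Collect_eq case_prod_conv) blast
  then have "\<tau> = prefix_reversal m j \<epsilon> \<sigma> \<or> \<tau> = prefix_reversal m j (- \<epsilon>) \<sigma>"
    using prefix_reversal_inverse[OF assms(1)] by metis
  moreover have "(j, \<epsilon>) \<in> {1..n} \<times> {1, -1}" "(j, - \<epsilon>) \<in> {1..n} \<times> {1, -1}" using * by auto
  ultimately show "\<tau> \<in> ?R" by force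
next
  fix \<tau> assume "\<tau> \<in> ?R"
  then show "\<tau> \<in> ?L"
    using prefix_reversal_in_coloured_perms[OF _ assms] \<sigma>
    unfolding pancake_graph_def by fastforce
qed

text \<open>The first entry of the result determines the reversal: its value is \<open>\<psi>(j)\<close>, which gives \<open>j\<close>,
  and its colour then gives \<open>\<epsilon>\<close>, as \<open>1\<close> and \<open>-1\<close> are distinct modulo \<open>m\<close>.  Hence no neighbour is
  counted twice when the adjacency matrix, with entries 0 and 1, is replaced by a sum over reversals.\<close>

lemma inj_on_prefix_reversal:
  assumes "m \<ge> 3" and \<sigma>: "\<sigma> \<in> coloured_perms m n"
  shows "inj_on (\<lambda>(j, \<epsilon>). prefix_reversal m j \<epsilon> \<sigma>) ({1..n} \<times> {1, -1})"
proof (rule inj_onI, clarify)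
  fix j j' :: nat and \<epsilon> \<epsilon>' :: int
  assume j: "j \<in> {1..n}" "j' \<in> {1..n}" and e: "\<epsilon> \<in> {1, -1}" "\<epsilon>' \<in> {1, -1}"
    and eq: "prefix_reversal m j \<epsilon> \<sigma> = prefix_reversal m j' \<epsilon>' \<sigma>"
  obtain \<chi> \<psi> where s: "\<sigma> = (\<chi>, \<psi>)" by force
  have inj: "inj \<psi>" using \<sigma> s permutes_inj by (auto simp: coloured_perms_def)
  have "fst (prefix_reversal m j \<epsilon> \<sigma>) 1 = fst (prefix_reversal m j' \<epsilon>' \<sigma>) 1"
    "snd (prefix_reversal m j \<epsilon> \<sigma>) 1 = snd (prefix_reversal m j' \<epsilon>' \<sigma>) 1"
    using eq by auto
  then have c: "(\<chi> j + \<epsilon>) mod int m = (\<chi> j' + \<epsilon>') mod int m" and "\<psi> j = \<psi> j'"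
    using j by (auto simp: s prefix_reversal_def)
  with inj have jj: "j = j'" by (auto dest: injD)
  with c have "int m dvd \<epsilon> - \<epsilon>'" by (simp add: mod_eq_dvd_iff)
  then have "\<epsilon> = \<epsilon>'" using e assms(1) zdvd_imp_le[of "int m" 2] by auto
  with jj show "j = j' \<and> \<epsilon> = \<epsilon>'" by simp
qed

lemma sum_neighbours_pancake_graph:
  fixes f :: "_ \<Rightarrow> real"
  assumes "m \<ge> 3" and \<sigma>: "\<sigma> \<in> coloured_perms m n"
  shows "(\<Sum>\<tau>\<in>{\<tau> \<in> pverts (pancake_graph m n). (\<sigma>, \<tau>) \<in> parcs (pancake_graph m n)}. f \<tau>) =
    (\<Sum>j\<in>{1..n}. f (prefix_reversal m j 1 \<sigma>) + f (prefix_reversal m j (-1) \<sigma>))"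
proof -
  have m0: "m > 0" using assms(1) by simp
  have "(\<Sum>\<tau>\<in>{\<tau> \<in> pverts (pancake_graph m n). (\<sigma>, \<tau>) \<in> parcs (pancake_graph m n)}. f \<tau>) =
    (\<Sum>(j, \<epsilon>)\<in>{1..n} \<times> {1, -1}. f (prefix_reversal m j \<epsilon> \<sigma>))"
    using assms unfolding neighbours_pancake_graph[OF m0 \<sigma>] sum.reindex[OF inj_on_prefix_reversal[OF assms]]
    by (simp add: case_prod_beta)
  also have "\<dots> = (\<Sum>j\<in>{1..n}. \<Sum>\<epsilon>\<in>{1, -1}. f (prefix_reversal m j \<epsilon> \<sigma>))"
    by (rule sum.cartesian_product[symmetric])
  finally show ?thesis by simp
qed

section \<open>The eigenfunctions\<close>

text \<open>This is \<open>cos (\<pi> x / 2)\<close> on the integers.\<close>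

definition quarter_wave :: "int \<Rightarrow> real" where
  "quarter_wave x = (if x mod 4 = 0 then 1 else if x mod 4 = 2 then -1 else 0)"

lemma quarter_wave_mod:
  assumes "4 dvd m"
  shows "quarter_wave (x mod int m - c) = quarter_wave (x - c)"
proof -
  have "4 dvd int m" using assms by presburger
  then have "(x mod int m - c) mod 4 = (x - c) mod 4"
    by (metis mod_diff_left_eq mod_mod_cancel)
  then show ?thesis by (simp add: quarter_wave_def)
qed

lemma quarter_wave_neighbours: "quarter_wave (x + 1) + quarter_wave (x - 1) = 0"
proof -
  have "x mod 4 \<in> {0, 1, 2, 3}" by auto
  moreover have "(x + 1) mod 4 = (x mod 4 + 1) mod 4" "(x - 1) mod 4 = (x mod 4 - 1) mod 4"
    by (simp_all add: mod_simps)
  ultimately show ?thesis by (auto simp: quarter_wave_def)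
qed

text \<open>The phases \<open>c = 0\<close> and \<open>c = 1\<close> give a cosine and a sine of the colour.\<close>

definition wave_at :: "nat \<Rightarrow> nat \<times> int \<Rightarrow> (nat \<Rightarrow> int) \<times> (nat \<Rightarrow> nat) \<Rightarrow> real" where
  "wave_at q = (\<lambda>(v, c) (\<chi>, \<psi>). if \<psi> q = v then quarter_wave (\<chi> q - c) else 0)"

text \<open>Short prefixes leave position \<open>k + 1\<close> alone; longer ones cancel in pairs, since
  \<open>cos (y + \<pi>/2) + cos (y - \<pi>/2) = 0\<close>.\<close>

lemma wave_at_eigenfunction:
  assumes "m > 0" and "4 dvd m" and k: "k < n" and \<sigma>: "\<sigma> \<in> coloured_perms m n"
  shows "(\<Sum>\<tau>\<in>{\<tau> \<in> pverts (pancake_graph m n). (\<sigma>, \<tau>) \<in> parcs (pancake_graph m n)}.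
      wave_at (k + 1) i \<tau>) = 2 * real k * wave_at (k + 1) i \<sigma>"
proof -
  obtain \<chi> \<psi> v c where s: "\<sigma> = (\<chi>, \<psi>)" and i: "i = (v, c)" by (metis surj_pair)
  have m: "m \<ge> 3" using assms(1,2) by (auto dest: dvd_imp_le)
  have "wave_at (k + 1) i (prefix_reversal m j 1 \<sigma>) + wave_at (k + 1) i (prefix_reversal m j (-1) \<sigma>)
      = (if j \<le> k then 2 * wave_at (k + 1) i \<sigma> else 0)" for j
  proof (cases "j \<le> k")
    case True
    then show ?thesis by (simp add: s i wave_at_def prefix_reversal_def)
  next
    case False
    have "quarter_wave ((x + 1) mod int m - c) + quarter_wave ((x + (-1)) mod int m - c) = 0" for x
      using quarter_wave_neighbours[of "x - c"]
      unfolding quarter_wave_mod[OF assms(2)] by (simp add: algebra_simps)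
    with False show ?thesis by (simp add: s i wave_at_def prefix_reversal_def)
  qed
  then have "(\<Sum>\<tau>\<in>{\<tau> \<in> pverts (pancake_graph m n). (\<sigma>, \<tau>) \<in> parcs (pancake_graph m n)}.
      wave_at (k + 1) i \<tau>) = (\<Sum>j\<in>{1..n}. if j \<le> k then 2 * wave_at (k + 1) i \<sigma> else 0)"
    unfolding sum_neighbours_pancake_graph[OF m \<sigma>] by simp
  also have "\<dots> = (\<Sum>j\<in>{1..k}. 2 * wave_at (k + 1) i \<sigma>)"
    using k by (intro sum.mono_neutral_cong_right) auto
  finally show ?thesis by simp
qed

lemma eigenvalue_mult_pancake_graph_ge:
  assumes "m > 0" and "4 dvd m" and k: "k < n"
  shows "2 * n \<le> eigenvalue_mult (pancake_graph m n) (2 * real k)"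
proof -
  define I where "I = {1..n} \<times> {0, 1 :: int}"
  \<comment> \<open>The vertex \<open>p (v, c)\<close> carries the value \<open>v\<close> with colour \<open>c\<close> at position \<open>k + 1\<close>.\<close>
  define p :: "nat \<times> int \<Rightarrow> (nat \<Rightarrow> int) \<times> (nat \<Rightarrow> nat)" where
    "p = (\<lambda>(v, c). (\<lambda>t. if t \<in> {1..n} then c else undefined, transpose (k + 1) v))"
  have m: "m \<ge> 4" using assms(1,2) by (auto dest: dvd_imp_le)
  have "card I \<le> eigenvalue_mult (pancake_graph m n) (2 * real k)"
  proof (rule card_le_eigenvalue_mult)
    show "finite (pverts (pancake_graph m n))"
      by (simp add: pancake_graph_def finite_coloured_perms)
    show "finite I" by (simp add: I_def)
    show "p i \<in> pverts (pancake_graph m n)" if "i \<in> I" for i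
      using that m k
      by (auto simp: I_def p_def pancake_graph_def coloured_perms_def PiE_iff extensional_def
          intro!: permutes_swap_id)
    show "wave_at (k + 1) i (p j) = (if i = j then 1 else 0)" if "i \<in> I" "j \<in> I" for i j
    proof -
      obtain v c v' c' where i: "i = (v, c)" and j: "j = (v', c')" by (metis surj_pair)
      have "wave_at (k + 1) i (p j) = (if v' = v then quarter_wave (c' - c) else 0)"
        using k by (simp add: i j p_def wave_at_def)
      moreover have "c \<in> {0, 1}" "c' \<in> {0, 1}" using that by (auto simp: I_def i j)
      then have "quarter_wave (c' - c) = (if c = c' then 1 else 0)"
        by (auto simp: quarter_wave_def)
      ultimately show ?thesis by (cases "c = c'") (simp_all add: i j)
    qed
  next
    show "(\<Sum>\<tau>\<in>{\<tau> \<in> pverts (pancake_graph m n). (\<sigma>, \<tau>) \<in> parcs (pancake_graph m n)}.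
        wave_at (k + 1) i \<tau>) = 2 * real k * wave_at (k + 1) i \<sigma>"
      if "\<sigma> \<in> pverts (pancake_graph m n)" for i \<sigma>
      using that by (intro wave_at_eigenfunction[OF assms]) (simp add: pancake_graph_def)
  qed
  then show ?thesis by (simp add: I_def mult.commute)
qed

theorem theorem1p2:
  fixes m n k :: nat
  assumes "m > 0" and "m mod 4 = 0"
    and "n \<ge> 2"
    and "1 \<le> k" and "k \<le> n - 1"
  shows "eigenvalue_mult (pancake_graph m n) (2 * real k) \<ge> (if k = n div 2 then 2 else 3)"
proof -
  have "(if k = n div 2 then 2 else 3) \<le> 2 * n" using \<open>n \<ge> 2\<close> by simp
  also have "\<dots> \<le> eigenvalue_mult (pancake_graph m n) (2 * real k)"
    using assms by (intro eigenvalue_mult_pancake_graph_ge) (auto simp: dvd_eq_mod_eq_0)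
  finally show ?thesis .
qed

end
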